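(* Let $n\ge1$ and let $S=\{s_1,\dots,s_k\}$ with $1\le s_1<\dots<s_k<n$. Then $$\kappa_n(S)=\prod_{r=1}^{k+1} r^{\,s_r-s_{r-1}},$$ where $s_0=0$ and $s_{k+1}=n$.
   Context: $\mathcal{S}_n$ is the set of permutations of $[n]=\{1,\dots,n\}$, written as words $\pi=a_1\cdots a_n$. The set of ascent bottoms is $A(\pi)=\{a_i : i\in[n-1],\ a_i<a_{i+1}\}$, and $\kappa_n(S)=|\{\pi\in\mathcal{S}_n : A(\pi)\subseteq S\}|$. *)

theory Defs
  imports "HOL-Combinatorics.Multiset_Permutations"
begin

(* Words are 0-indexed lists, so a_i is xs ! (i - 1); i + 1 < length xs encodes i \<in> [n - 1]. *)

definition ascent_bottoms :: "nat list \<Rightarrow> nat set" where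
  "ascent_bottoms xs = {xs ! i | i. i + 1 < length xs \<and> xs ! i < xs ! (i + 1)}"

definition kappa :: "nat \<Rightarrow> nat set \<Rightarrow> nat" where
  "kappa n S = card {xs \<in> permutations_of_set {1..n}. ascent_bottoms xs \<subseteq> S}"

end

(* Deleting the maximum m from a word u m v removes only the letter preceding m from the ascent
   bottoms: if last u < hd v then last u is an ascent bottom before and after. So m can be inserted
   into an admissible word exactly at the front or directly after a letter of S. Hence
   kappa_n(S) is the product over m in [n] of 1 + |S \<inter> [m - 1]|, and this factor equals r
   for s_{r-1} < m \<le> s_r. *)
theory Submission
  imports Defs
begin

lemma ascent_bottoms_Nil [simp]: "ascent_bottoms [] = {}"
  and ascent_bottoms_single [simp]: "ascent_bottoms [x] = {}"
  by (auto simp: ascent_bottoms_def)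

lemma ascent_bottoms_Cons_Cons [simp]:
  "ascent_bottoms (x # y # zs) = (if x < y then {x} else {}) \<union> ascent_bottoms (y # zs)"
proof -
  \<comment> \<open>Index 0 is the comparison of \<open>x\<close> with \<open>y\<close>; the
    successor indices are exactly the positions of \<open>y # zs\<close>.\<close>
  have step: "(\<exists>i. P i) \<longleftrightarrow> P 0 \<or> (\<exists>i. P (Suc i))" for P :: "nat \<Rightarrow> bool"
    by (metis not0_implies_Suc)
  have "a \<in> ascent_bottoms (x # y # zs) \<longleftrightarrow> x < y \<and> a = x \<or> a \<in> ascent_bottoms (y # zs)" for a
    unfolding ascent_bottoms_def mem_Collect_eq by (subst step) auto
  then show ?thesis by auto
qed

text \<open>The letter \<open>m\<close> is never an ascent bottom, while any letter before it always
  is. The union covers both cases for \<open>last u\<close>, whether or not it was an ascent bottom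
  already. The induction peels \<open>u\<close> from the front: with two or more letters left, the
  first comparison does not involve \<open>m\<close>.\<close>

lemma ascent_bottoms_insert_max:
  assumes "\<And>x. x \<in> set (u @ v) \<Longrightarrow> x < m"
  shows "ascent_bottoms (u @ m # v) = ascent_bottoms (u @ v) \<union> (if u = [] then {} else {last u})"
proof -
  have front: "ascent_bottoms (m # v) = ascent_bottoms v"
  proof (cases v)
    case (Cons a list)
    then have "a < m" using assms by simp
    then show ?thesis using Cons by simp
  qed simp
  show ?thesis
    using assms
  proof (induction u rule: induct_list012)
    case 1
    then show ?case using front by simp
  next
    case (2 x)
    then show ?case using front by (cases v) auto
  next
    case (3 x y zs)
    then show ?case by auto
  qed
qed

text \<open>Here \<open>i\<close> is the number of letters to the left of the insertion point. Apart
  from the front, such points correspond to positions of letters of \<open>S\<close> in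
  \<open>w\<close>, and distinctness turns positions into letters.\<close>

lemma card_admissible_insertions:
  assumes "distinct w"
  shows "card {i. i \<le> length w \<and> (i = 0 \<or> w ! (i - 1) \<in> S)} = Suc (card (S \<inter> set w))"
proof -
  let ?J = "{j. j < length w \<and> w ! j \<in> S}"
  have "{i. i \<le> length w \<and> (i = 0 \<or> w ! (i - 1) \<in> S)} = insert 0 (Suc ` ?J)"
  proof (intro set_eqI)
    fix i show "i \<in> {i. i \<le> length w \<and> (i = 0 \<or> w ! (i - 1) \<in> S)} \<longleftrightarrow> i \<in> insert 0 (Suc ` ?J)"
      by (cases i) auto
  qed
  moreover have "(!) w ` ?J = S \<inter> set w"
    by (auto simp: in_set_conv_nth)
  then have "card (S \<inter> set w) = card ?J"
    using assms by (metis (no_types, lifting) card_image inj_on_nth mem_Collect_eq)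
  ultimately show ?thesis
    by (simp add: card_image)
qed

lemma card_ascent_bottoms_subset_insert_max:
  assumes "finite V" and max: "\<And>x. x \<in> V \<Longrightarrow> x < m"
  shows "card {xs \<in> permutations_of_set (insert m V). ascent_bottoms xs \<subseteq> S} =
    card {xs \<in> permutations_of_set V. ascent_bottoms xs \<subseteq> S} * Suc (card (S \<inter> V))"
proof -
  let ?P = "\<lambda>V. {xs \<in> permutations_of_set V. ascent_bottoms xs \<subseteq> S}"
  let ?I = "\<lambda>w. {i. i \<le> length w \<and> (i = 0 \<or> w ! (i - 1) \<in> S)}"
  let ?f = "\<lambda>(w, i). take i w @ m # drop i w"
  have m: "m \<notin> V" using max by auto
  have insert_iff: "u @ m # v \<in> ?P (insert m V) \<longleftrightarrow> u @ v \<in> ?P V \<and> (u = [] \<or> last u \<in> S)" for u v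
  proof (cases "u @ v \<in> permutations_of_set V")
    case True
    then have "set (u @ v) = V" and "distinct (u @ v)"
      by (simp_all only: permutations_of_setD)
    then have "u @ m # v \<in> permutations_of_set (insert m V)"
      using m by (auto simp: permutations_of_set_def)
    moreover have "ascent_bottoms (u @ m # v) =
        ascent_bottoms (u @ v) \<union> (if u = [] then {} else {last u})"
      using max \<open>set (u @ v) = V\<close> by (intro ascent_bottoms_insert_max) auto
    ultimately show ?thesis
      using True by auto
  next
    case False
    then show ?thesis
      using m by (auto simp: permutations_of_set_def)
  qed
  \<comment> \<open>This restates the condition on the prefix \<open>u\<close> in
    \<open>insert_iff\<close> as one on the insertion index.\<close>
  have position: "take i w = [] \<or> last (take i w) \<in> S \<longleftrightarrow> i = 0 \<or> w ! (i - 1) \<in> S"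
    if "i \<le> length w" for i and w :: "nat list"
    using that by (cases i) (auto simp: take_Suc_conv_app_nth)
  have "bij_betw ?f (Sigma (?P V) ?I) (?P (insert m V))"
    unfolding bij_betw_def
  proof (intro conjI inj_onI equalityI subsetI)
    fix p q
    assume "p \<in> Sigma (?P V) ?I" "q \<in> Sigma (?P V) ?I" and eq: "?f p = ?f q"
    then obtain w i w' i' where pq: "p = (w, i)" "q = (w', i')"
      and w: "set w = V" "i \<le> length w" "set w' = V" "i' \<le> length w'"
      by (auto simp: permutations_of_set_def)
    \<comment> \<open>The inserted \<open>m\<close> occurs only once, so it determines the pieces on
      either side; the index is then the length of the left piece.\<close>
    have "m \<notin> set (take i w)" "m \<notin> set (take i' w')"
      "m \<notin> set (drop i w)" "m \<notin> set (drop i' w')"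
      using m w by (auto dest: in_set_takeD in_set_dropD)
    then have "take i w = take i' w'" "drop i w = drop i' w'"
      using eq pq by (auto simp: append_Cons_eq_iff)
    then show "p = q"
      using pq w by (metis append_take_drop_id length_take min.absorb2)
  next
    fix xs assume "xs \<in> ?f ` Sigma (?P V) ?I"
    then obtain w i where w: "w \<in> ?P V" "i \<in> ?I w" "xs = take i w @ m # drop i w"
      by auto
    then show "xs \<in> ?P (insert m V)"
      using position[of i w] by (simp only: insert_iff append_take_drop_id) blast
  next
    fix xs assume xs: "xs \<in> ?P (insert m V)"
    then have "m \<in> set xs"
      by (auto simp: permutations_of_set_def)
    then obtain u v where uv: "xs = u @ m # v"
      by (meson split_list)
    then have "u @ v \<in> ?P V" "u = [] \<or> last u \<in> S"
      using xs insert_iff by blast+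
    then have "(u @ v, length u) \<in> Sigma (?P V) ?I"
      using position[of "length u" "u @ v"] by auto
    moreover have "xs = ?f (u @ v, length u)"
      using uv by simp
    ultimately show "xs \<in> ?f ` Sigma (?P V) ?I"
      by blast
  qed
  then have "card (?P (insert m V)) = card (Sigma (?P V) ?I)"
    by (simp add: bij_betw_same_card)
  also have "\<dots> = (\<Sum>w\<in>?P V. card (?I w))"
    by (rule card_SigmaI) auto
  \<comment> \<open>Every \<open>w\<close> has letter set \<open>V\<close>, so the number of
    insertion points does not depend on \<open>w\<close> and the sum becomes a product.\<close>
  also have "\<dots> = (\<Sum>w\<in>?P V. Suc (card (S \<inter> V)))"
    by (intro sum.cong refl, subst card_admissible_insertions) (auto simp: permutations_of_set_def)
  finally show ?thesis
    by simp
qed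

text \<open>A word on [n] is built by inserting 1, ..., n in increasing order, each letter being the
  maximum when it arrives; the factor for \<open>m\<close> counts its allowed places.\<close>

lemma kappa_eq_prod: "kappa n S = (\<Prod>m = 1..n. Suc (card (S \<inter> {1..<m})))"
proof (induction n)
  case 0
  have "{xs. xs = [] \<and> ascent_bottoms xs \<subseteq> S} = {[]}"
    by auto
  then show ?case by (simp add: kappa_def)
next
  case (Suc n)
  have "kappa (Suc n) S = kappa n S * Suc (card (S \<inter> {1..n}))"
    using card_ascent_bottoms_subset_insert_max[of "{1..n}" "Suc n" S]
    by (simp add: kappa_def atLeastAtMostSuc_conv)
  then show ?case
    using Suc by (simp add: atLeastLessThanSuc_atLeastAtMost)
qed

theorem corollary7:
  fixes n k :: nat and s :: "nat \<Rightarrow> nat" and S :: "nat set"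
  assumes "n \<ge> 1"
    and "S = s ` {1..k}"
    and "strict_mono_on {1..k} s"
    and "\<And>r. r \<in> {1..k} \<Longrightarrow> 1 \<le> s r \<and> s r < n"
    and "s 0 = 0" and "s (k + 1) = n"
  shows "kappa n S = (\<Prod>r = 1..k + 1. r ^ (s r - s (r - 1)))"
proof -
  \<comment> \<open>Strict monotonicity is extended to the boundary values \<open>s 0 = 0\<close>
    and \<open>s (k + 1) = n\<close>, so that the first and last blocks need no separate
    treatment.\<close>
  have less: "s i < s j" if "i < j" "j \<le> k + 1" for i j
  proof (cases "i = 0 \<or> j = k + 1")
    case True
    then show ?thesis
      using that assms(1,4-6) by (cases "j = k + 1"; cases "i = 0") (force simp: Suc_le_eq)+
  next
    case False
    then show ?thesis
      using that assms(3) by (auto simp: strict_mono_on_def)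
  qed
  \<comment> \<open>Stopping the product at \<open>s j\<close> allows induction over blocks;
    \<open>j = k + 1\<close> gives the theorem.\<close>
  have "(\<Prod>m = 1..s j. Suc (card (S \<inter> {1..<m}))) = (\<Prod>r = 1..j. r ^ (s r - s (r - 1)))"
    if "j \<le> k + 1" for j
    using that
  proof (induction j)
    case 0
    then show ?case using assms(5) by simp
  next
    case (Suc j)
    \<comment> \<open>Within the block above \<open>s j\<close>, the elements of \<open>S\<close>
      below \<open>m\<close> are exactly \<open>s 1\<close>, ..., \<open>s j\<close>, so all factors
      of the block equal \<open>Suc j\<close>. The strict bound on \<open>{1..<m}\<close> keeps
      \<open>s (Suc j)\<close> out even when \<open>m\<close> equals it.\<close>
    have factor: "card (S \<inter> {1..<m}) = j" if m: "m \<in> {s j<..s (Suc j)}" for m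
    proof -
      have "s i < m \<longleftrightarrow> i \<le> j" if "i \<in> {1..k}" for i
      proof
        assume "i \<le> j"
        then have "s i \<le> s j"
          using less[of i j] Suc.prems by (cases "i = j") auto
        then show "s i < m" using m by simp
      next
        assume "s i < m"
        show "i \<le> j"
        proof (rule ccontr)
          assume "\<not> i \<le> j"
          then have "s (Suc j) \<le> s i"
            using less[of "Suc j" i] that by (cases "i = Suc j") auto
          with \<open>s i < m\<close> m show False by simp
        qed
      qed
      then have "S \<inter> {1..<m} = s ` {1..j}"
        using assms(2,4) Suc.prems by fastforce
      moreover have "inj_on s {1..j}"
        using less Suc.prems by (intro linorder_inj_onI) force+
      ultimately show ?thesis
        by (simp add: card_image)
    qed
    have "{1..s (Suc j)} = {1..s j} \<union> {s j<..s (Suc j)}"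
      using less[of j "Suc j"] Suc.prems by auto
    then have "(\<Prod>m = 1..s (Suc j). Suc (card (S \<inter> {1..<m}))) =
        (\<Prod>m = 1..s j. Suc (card (S \<inter> {1..<m}))) *
        (\<Prod>m\<in>{s j<..s (Suc j)}. Suc (card (S \<inter> {1..<m})))"
      by (simp only:) (rule prod.union_disjoint; auto)
    also have "(\<Prod>m\<in>{s j<..s (Suc j)}. Suc (card (S \<inter> {1..<m}))) = Suc j ^ (s (Suc j) - s j)"
      using factor by simp
    finally show ?case
      using Suc by simp
  qed
  from this[of "k + 1"] show ?thesis
    using assms(6) by (simp add: kappa_eq_prod)
qed

end
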